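(* Let $\beta,\gamma>0$ and let $(\mathbf{x}^\star,\mathbf{y}^\star)\in\mathbb{R}^N\times\mathbb{R}^N$ be given. Then $(\mathbf{x}^\star,\mathbf{y}^\star)$ is a local minimizer of the (non-convex) problem of minimizing $F(\mathbf{x},\mathbf{y})$ over $(\mathbf{x},\mathbf{y})\in\mathbb{R}^N\times\mathbb{R}^N$ if and only if $(\mathbf{x}^\star,\mathbf{y}^\star)$ is a (global) minimizer of the convex problem of minimizing $G(\mathbf{x},\mathbf{y})$ over $(\mathbf{x},\mathbf{y})\in\mathcal{B}_{\mathcal{N}}\times\mathbb{R}^N$ with $\mathcal{N}:=N(\mathbf{x}^\star)$.
   Context: Let $d,M,N$ be positive integers with $d<M\le N$. $\mathbf{F}$ is the $M\times M$ discrete Fourier matrix $\mathbf{F}_{mn}=\frac{1}{\sqrt{M}}\exp\left(-i\frac{2\pi(m-1)(n-1)}{M}\right)$. $\mathbf{R}$ is a $d\times M$ row selector matrix: it consists of $d$ distinct rows of the $M\times M$ identity matrix, chosen so that for $2\le m\le M$, if the $m$-th row is included then so is the $(M-m+2)$-th row. $\mathbf{W}$ is an $N\times M$ tight framelet matrix, i.e. a real matrix with $\mathbf{W}^*\mathbf{W}=\mathbf{I}$. Put $\mathbf{K}:=\mathbf{R}\mathbf{F}\mathbf{W}^*$ (a complex $d\times N$ matrix; $*$ is conjugate transpose). The vector $\mathbf{r}\in\mathbb{R}^d$ is fixed, and $\|\cdot\|_2$ is the Euclidean norm (on $\mathbb{R}^N$ or $\mathbb{C}^d$). $\|\mathbf{x}\|_0$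 is the number of nonzero components of $\mathbf{x}\in\mathbb{R}^N$. For $\mathbf{x},\mathbf{y}\in\mathbb{R}^N$, $$G(\mathbf{x},\mathbf{y}):=\tfrac12\|\mathbf{K}\mathbf{y}-\mathbf{r}\|_2^2+\tfrac{\gamma}{2\beta}\|\mathbf{x}-\mathbf{y}\|_2^2,\qquad F(\mathbf{x},\mathbf{y}):=G(\mathbf{x},\mathbf{y})+\gamma\|\mathbf{x}\|_0 .$$ $N(\mathbf{x}):=\{i: x_i\ne 0\}$ is the support of $\mathbf{x}$, and for $\mathcal{N}\subseteq\{1,\dots,N\}$, $\mathcal{B}_{\mathcal{N}}:=\{\mathbf{x}\in\mathbb{R}^N: N(\mathbf{x})\subseteq\mathcal{N}\}$. $(\mathbf{x}^\star,\mathbf{y}^\star)$ is a local minimizer of $F$ if there is $\delta>0$ such that $F(\mathbf{x}^\star,\mathbf{y}^\star)\le F(\mathbf{x}^\star+\Delta\mathbf{x},\mathbf{y}^\star+\Delta\mathbf{y})$ for all $\|\Delta\mathbf{x}\|\le\delta$, $\|\Delta\mathbf{y}\|\le\delta$. *)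

theory Defs
  imports "HOL-Analysis.Analysis"
begin

text \<open>
  The dimensions d, M, N are the cardinalities of the index types \<open>'d\<close>, \<open>'m\<close>, \<open>'n\<close>; a matrix with
  \<open>'a\<close>-indexed rows and \<open>'b\<close>-indexed columns has type \<open>_ ^ 'b ^ 'a\<close>. Only for \<open>'m\<close> do the
  numbers of the indices matter (in the Fourier matrix and in the symmetry condition on the row
  selector), so \<open>'m\<close> is linearly ordered and its elements are numbered 1, ..., M in increasing order.
\<close>

definition index_no :: "'m::{finite,linorder} \<Rightarrow> nat" where
  "index_no m = card {..m}"

definition conj_transpose :: "complex ^ 'b ^ 'a \<Rightarrow> complex ^ 'a ^ 'b" where
  "conj_transpose A = (\<chi> i j. cnj (A $ j $ i))"

definition complex_vec :: "real ^ 'a \<Rightarrow> complex ^ 'a" where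
  "complex_vec x = (\<chi> i. complex_of_real (x $ i))"

definition complex_mat :: "real ^ 'b ^ 'a \<Rightarrow> complex ^ 'b ^ 'a" where
  "complex_mat A = (\<chi> i j. complex_of_real (A $ i $ j))"

definition fourier_matrix :: "complex ^ ('m::{finite,linorder}) ^ ('m::{finite,linorder})" where
  "fourier_matrix = (\<chi> m n. complex_of_real (1 / sqrt (real CARD('m))) *
     exp (- (\<i> * complex_of_real
       (2 * pi * (real (index_no m) - 1) * (real (index_no n) - 1) / real CARD('m)))))"

text \<open>
  In the symmetry condition, the row \<open>m'\<close> has number M - m + 2, written without natural-number
  subtraction. The selected rows may be listed in any order.
\<close>

definition row_selector :: "complex ^ ('m::{finite,linorder}) ^ 'd \<Rightarrow> bool" where
  "row_selector R \<longleftrightarrow>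
     (\<exists>s :: 'd \<Rightarrow> 'm. inj s \<and>
        (\<forall>i. row i R = row (s i) (mat 1)) \<and>
        (\<forall>m m'. index_no m \<ge> 2 \<and> index_no m' + index_no m = CARD('m) + 2 \<and> m \<in> range s
            \<longrightarrow> m' \<in> range s))"

definition tight_framelet :: "real ^ 'm ^ 'n \<Rightarrow> bool" where
  "tight_framelet W \<longleftrightarrow> transpose W ** W = mat 1"

definition K_matrix ::
  "complex ^ ('m::{finite,linorder}) ^ 'd \<Rightarrow> real ^ ('m::{finite,linorder}) ^ 'n \<Rightarrow> complex ^ 'n ^ 'd" where
  "K_matrix R W = R ** fourier_matrix ** conj_transpose (complex_mat W)"

definition supp :: "real ^ 'n \<Rightarrow> 'n set" where
  "supp x = {i. x $ i \<noteq> 0}"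

definition norm0 :: "real ^ 'n \<Rightarrow> nat" where
  "norm0 x = card (supp x)"

definition supported_on :: "'n set \<Rightarrow> (real ^ 'n) set" where
  "supported_on S = {x. supp x \<subseteq> S}"

definition G_fun ::
  "complex ^ 'n ^ 'd \<Rightarrow> real ^ 'd \<Rightarrow> real \<Rightarrow> real \<Rightarrow> real ^ 'n \<Rightarrow> real ^ 'n \<Rightarrow> real" where
  "G_fun K r \<beta> \<gamma> x y =
     1 / 2 * (norm (K *v complex_vec y - complex_vec r))\<^sup>2 + \<gamma> / (2 * \<beta>) * (norm (x - y))\<^sup>2"

definition F_fun ::
  "complex ^ 'n ^ 'd \<Rightarrow> real ^ 'd \<Rightarrow> real \<Rightarrow> real \<Rightarrow> real ^ 'n \<Rightarrow> real ^ 'n \<Rightarrow> real" where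
  "F_fun K r \<beta> \<gamma> x y = G_fun K r \<beta> \<gamma> x y + \<gamma> * real (norm0 x)"

definition local_minimizer ::
  "(real ^ 'n \<Rightarrow> real ^ 'n \<Rightarrow> real) \<Rightarrow> real ^ 'n \<Rightarrow> real ^ 'n \<Rightarrow> bool" where
  "local_minimizer f x y \<longleftrightarrow>
     (\<exists>\<delta>>0. \<forall>\<Delta>x \<Delta>y. norm \<Delta>x \<le> \<delta> \<and> norm \<Delta>y \<le> \<delta> \<longrightarrow> f x y \<le> f (x + \<Delta>x) (y + \<Delta>y))"

end

(* The penalty term is constant on the vectors with support supp xs, does not increase when the
   support shrinks, and jumps by at least \<gamma> when the support grows.  If (xs, ys) is a local
   minimizer of F, then moving slightly towards a feasible point of the convex problem does not
   increase the penalty, so G cannot decrease, and convexity of G turns this into global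
   minimality.  Conversely, a small perturbation of xs keeps the support or enlarges it; in the
   first case minimality of G applies, in the second the jump \<gamma> outweighs the small change of the continuous function G. *)
theory Submission
  imports Defs
begin

text \<open>Linearity is over the reals, since the argument is a real vector. Both convexity and
  continuity of the data term of \<open>G_fun\<close> rest on it.\<close>

lemma linear_complex_vec: "linear (\<lambda>x :: real ^ 'n. (A :: complex ^ 'n ^ 'd) *v complex_vec x)"
proof (rule linearI)
  fix x y :: "real ^ 'n" and c :: real
  show "A *v complex_vec (x + y) = A *v complex_vec x + A *v complex_vec y"
    by (simp add: vec_eq_iff matrix_vector_mult_def complex_vec_def distrib_left sum.distrib)
  have "(A *v complex_vec (c *\<^sub>R x)) $ i = (c *\<^sub>R (A *v complex_vec x)) $ i" for i
    by (simp add: matrix_vector_mult_def complex_vec_def scaleR_sum_right)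
      (simp add: scaleR_conv_of_real mult.left_commute)
  then show "A *v complex_vec (c *\<^sub>R x) = c *\<^sub>R (A *v complex_vec x)"
    by (simp add: vec_eq_iff)
qed

text \<open>The gap between the two sides is exactly t (1 - t) times the squared norm of u -
  v.\<close>

lemma norm_power2_convex:
  fixes u v :: "'a::real_inner"
  assumes "0 \<le> t" "t \<le> 1"
  shows "(norm ((1 - t) *\<^sub>R u + t *\<^sub>R v))\<^sup>2 \<le> (1 - t) * (norm u)\<^sup>2 + t * (norm v)\<^sup>2"
proof -
  have "(1 - t) * (norm u)\<^sup>2 + t * (norm v)\<^sup>2 - (norm ((1 - t) *\<^sub>R u + t *\<^sub>R v))\<^sup>2
      = t * (1 - t) * (norm (u - v))\<^sup>2"
    unfolding power2_norm_eq_inner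
    by (simp add: inner_left_distrib inner_right_distrib inner_diff_left inner_diff_right
        inner_commute algebra_simps)
  also have "\<dots> \<ge> 0"
    using assms by simp
  finally show ?thesis
    by simp
qed

text \<open>Both terms are nonnegative multiples of squared norms of affine functions of the pair,
  so convexity is joint in x and y.\<close>

lemma G_fun_convex:
  fixes K :: "complex ^ 'n ^ 'd"
  assumes "\<beta> > 0" "\<gamma> > 0" and t: "0 \<le> t" "t \<le> 1"
  shows "G_fun K r \<beta> \<gamma> ((1 - t) *\<^sub>R x + t *\<^sub>R x') ((1 - t) *\<^sub>R y + t *\<^sub>R y')
    \<le> (1 - t) * G_fun K r \<beta> \<gamma> x y + t * G_fun K r \<beta> \<gamma> x' y'"
proof -
  let ?A = "\<lambda>y. K *v complex_vec y" and ?b = "complex_vec r"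
  interpret linear ?A
    by (rule linear_complex_vec)
  \<comment> \<open>The offset \<open>?b\<close> splits along with the linear part because the
    weights 1 - t and t sum to 1.\<close>
  have A: "?A ((1 - t) *\<^sub>R y + t *\<^sub>R y') - ?b
      = (1 - t) *\<^sub>R (?A y - ?b) + t *\<^sub>R (?A y' - ?b)"
    by (simp only: add scale) (simp add: algebra_simps)
  have xy: "((1 - t) *\<^sub>R x + t *\<^sub>R x') - ((1 - t) *\<^sub>R y + t *\<^sub>R y')
      = (1 - t) *\<^sub>R (x - y) + t *\<^sub>R (x' - y')"
    by (simp add: algebra_simps)
  have "G_fun K r \<beta> \<gamma> ((1 - t) *\<^sub>R x + t *\<^sub>R x') ((1 - t) *\<^sub>R y + t *\<^sub>R y')
    \<le> 1 / 2 * ((1 - t) * (norm (?A y - ?b))\<^sup>2 + t * (norm (?A y' - ?b))\<^sup>2)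
      + \<gamma> / (2 * \<beta>) * ((1 - t) * (norm (x - y))\<^sup>2 + t * (norm (x' - y'))\<^sup>2)"
    unfolding G_fun_def A xy
    using assms by (intro add_mono mult_left_mono norm_power2_convex) auto
  also have "\<dots> = (1 - t) * G_fun K r \<beta> \<gamma> x y + t * G_fun K r \<beta> \<gamma> x' y'"
    by (simp only: G_fun_def distrib_left mult.left_commute add_ac)
  finally show ?thesis .
qed

lemma continuous_G_fun: "continuous_on UNIV (\<lambda>(x, y). G_fun K r \<beta> \<gamma> x y)"
proof -
  have "continuous_on UNIV (\<lambda>p :: (real ^ 'a) \<times> (real ^ 'a). K *v complex_vec (snd p))"
    by (intro linear_continuous_on_compose[OF _ linear_complex_vec] continuous_intros)
  then show ?thesis
    unfolding G_fun_def case_prod_beta by (intro continuous_intros)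
qed

lemma norm0_mono: "supp x \<subseteq> supp y \<Longrightarrow> norm0 x \<le> norm0 y"
  by (simp add: norm0_def card_mono)

lemma norm0_strict_mono: "supp x \<subset> supp y \<Longrightarrow> norm0 x < norm0 y"
  by (simp add: norm0_def psubset_card_mono)

lemma supp_perturb:
  fixes x :: "real ^ 'n"
  obtains \<delta> where "\<delta> > 0" "\<And>h. norm h < \<delta> \<Longrightarrow> supp x \<subseteq> supp (x + h)"
proof
  \<comment> \<open>The radius is the smallest modulus of a nonzero entry, capped at 1; the inserted
    1 keeps the set nonempty when x = 0.\<close>
  let ?S = "insert 1 ((\<lambda>i. \<bar>x $ i\<bar>) ` supp x)"
  show "Min ?S > 0"
    by (auto simp: supp_def)
  fix h :: "real ^ 'n"
  assume h: "norm h < Min ?S"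
  show "supp x \<subseteq> supp (x + h)"
  proof
    fix i
    assume "i \<in> supp x"
    then have "Min ?S \<le> \<bar>x $ i\<bar>"
      by (intro Min_le) auto
    then have "\<bar>h $ i\<bar> < \<bar>x $ i\<bar>"
      using h component_le_norm_cart[of h i] by linarith
    then have "x $ i + h $ i \<noteq> 0"
      by linarith
    then show "i \<in> supp (x + h)"
      by (simp add: supp_def)
  qed
qed

lemma local_minimizer_imp_minimizer:
  fixes K :: "complex ^ 'n ^ 'd"
  assumes "\<beta> > 0" "\<gamma> > 0"
    and loc: "local_minimizer (F_fun K r \<beta> \<gamma>) xs ys"
    and x: "supp x \<subseteq> supp xs"
  shows "G_fun K r \<beta> \<gamma> xs ys \<le> G_fun K r \<beta> \<gamma> x y"
proof -
  obtain \<delta> where "\<delta> > 0" and \<delta>: "\<And>h k. norm h \<le> \<delta> \<Longrightarrow> norm k \<le> \<delta> \<Longrightarrow>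
      F_fun K r \<beta> \<gamma> xs ys \<le> F_fun K r \<beta> \<gamma> (xs + h) (ys + k)"
    using loc unfolding local_minimizer_def by blast
  \<comment> \<open>C bounds both displacements, so scaling by t = \<delta> / C brings them within
    \<delta>. The summand \<delta> gives t \<le> 1 and keeps C positive even if both displacements
    vanish.\<close>
  define C where "C = norm (x - xs) + norm (y - ys) + \<delta>"
  define t where "t = \<delta> / C"
  have C: "C \<ge> \<delta>" "C \<ge> norm (x - xs)" "C \<ge> norm (y - ys)" "C > 0"
    using \<open>\<delta> > 0\<close> by (simp_all add: C_def add_nonneg_pos)
  have t: "0 < t" "t \<le> 1"
    using C \<open>\<delta> > 0\<close> by (simp_all add: t_def)
  have small: "norm (t *\<^sub>R v) \<le> \<delta>" if "norm v \<le> C" for v :: "real ^ 'n"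
    using that C \<open>\<delta> > 0\<close> by (simp add: t_def divide_le_eq mult_left_mono)
  let ?x = "(1 - t) *\<^sub>R xs + t *\<^sub>R x" and ?y = "(1 - t) *\<^sub>R ys + t *\<^sub>R y"
  have "F_fun K r \<beta> \<gamma> xs ys \<le> F_fun K r \<beta> \<gamma> (xs + t *\<^sub>R (x - xs)) (ys + t *\<^sub>R (y - ys))"
    using C by (intro \<delta> small)
  moreover have "xs + t *\<^sub>R (x - xs) = ?x" "ys + t *\<^sub>R (y - ys) = ?y"
    by (simp_all add: algebra_simps)
  ultimately have "F_fun K r \<beta> \<gamma> xs ys \<le> F_fun K r \<beta> \<gamma> ?x ?y"
    by simp
  \<comment> \<open>Where \<open>xs\<close> vanishes, so does x, and hence every point of the
    segment between them.\<close>
  moreover have "norm0 ?x \<le> norm0 xs"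
    using x by (intro norm0_mono) (auto simp: supp_def)
  then have "\<gamma> * real (norm0 ?x) \<le> \<gamma> * real (norm0 xs)"
    using \<open>\<gamma> > 0\<close> by simp
  ultimately have "G_fun K r \<beta> \<gamma> xs ys \<le> G_fun K r \<beta> \<gamma> ?x ?y"
    unfolding F_fun_def by linarith
  also have "\<dots> \<le> (1 - t) * G_fun K r \<beta> \<gamma> xs ys + t * G_fun K r \<beta> \<gamma> x y"
    using assms t by (intro G_fun_convex) auto
  \<comment> \<open>The share 1 - t of the value at (xs, ys) cancels; positivity of t then allows
    division.\<close>
  finally have "t * G_fun K r \<beta> \<gamma> xs ys \<le> t * G_fun K r \<beta> \<gamma> x y"
    by (simp add: algebra_simps)
  with t show ?thesis
    by simp
qed

lemma minimizer_imp_local_minimizer: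
  fixes K :: "complex ^ 'n ^ 'd"
  assumes "\<gamma> > 0"
    and min: "\<And>x y. supp x \<subseteq> supp xs \<Longrightarrow> G_fun K r \<beta> \<gamma> xs ys \<le> G_fun K r \<beta> \<gamma> x y"
  shows "local_minimizer (F_fun K r \<beta> \<gamma>) xs ys"
proof -
  obtain \<epsilon> where "\<epsilon> > 0" and \<epsilon>: "\<And>h. norm h < \<epsilon> \<Longrightarrow> supp xs \<subseteq> supp (xs + h)"
    using supp_perturb by blast
  \<comment> \<open>The tolerance for G is \<gamma>, the price of one additional nonzero
    entry.\<close>
  obtain \<eta> where "\<eta> > 0" and \<eta>: "\<And>p. dist p (xs, ys) < \<eta> \<Longrightarrow>
      dist (case p of (x, y) \<Rightarrow> G_fun K r \<beta> \<gamma> x y) (G_fun K r \<beta> \<gamma> xs ys) < \<gamma>"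
    using continuous_G_fun[of K r \<beta> \<gamma>] \<open>\<gamma> > 0\<close> unfolding continuous_on_iff by fastforce
  \<comment> \<open>Halving \<epsilon> turns the non-strict bound on h into a strict one; a third of
    \<eta> for each of h and k keeps the pair strictly within \<eta>.\<close>
  define \<delta> where "\<delta> = min (\<epsilon> / 2) (\<eta> / 3)"
  have "F_fun K r \<beta> \<gamma> xs ys \<le> F_fun K r \<beta> \<gamma> (xs + h) (ys + k)"
    if h: "norm h \<le> \<delta>" and k: "norm k \<le> \<delta>" for h k
  proof (cases "supp (xs + h) = supp xs")
    case True
    then show ?thesis
      using min[of "xs + h" "ys + k"] by (simp add: F_fun_def norm0_def)
  next
    case False
    have "dist (xs + h, ys + k) (xs, ys) \<le> norm h + norm k"
      using norm_Pair_le[of h k] by (simp add: dist_norm)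
    also have "\<dots> < \<eta>"
      using h k \<open>\<eta> > 0\<close> by (simp add: \<delta>_def)
    finally have "G_fun K r \<beta> \<gamma> xs ys - \<gamma> < G_fun K r \<beta> \<gamma> (xs + h) (ys + k)"
      using \<eta>[of "(xs + h, ys + k)"] by (simp add: dist_real_def)
    moreover have "supp xs \<subset> supp (xs + h)"
      using False \<epsilon>[of h] h \<open>\<epsilon> > 0\<close> by (auto simp: \<delta>_def)
    \<comment> \<open>Cardinalities are integers, so a strict increase is at least 1.\<close>
    then have "real (norm0 xs) + 1 \<le> real (norm0 (xs + h))"
      using norm0_strict_mono[of xs "xs + h"] by simp
    then have "\<gamma> * real (norm0 xs) + \<gamma> \<le> \<gamma> * real (norm0 (xs + h))"
      using mult_left_mono[of _ _ \<gamma>] \<open>\<gamma> > 0\<close> by (fastforce simp: distrib_left)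
    ultimately show ?thesis
      unfolding F_fun_def by linarith
  qed
  moreover have "\<delta> > 0"
    using \<open>\<epsilon> > 0\<close> \<open>\<eta> > 0\<close> by (simp add: \<delta>_def)
  ultimately show ?thesis
    unfolding local_minimizer_def by blast
qed

theorem theorem1:
  fixes R :: "complex ^ ('m::{finite,linorder}) ^ 'd"
    and W :: "real ^ ('m::{finite,linorder}) ^ 'n"
    and K :: "complex ^ 'n ^ 'd"
    and r :: "real ^ 'd"
    and \<beta> \<gamma> :: real
    and xs ys :: "real ^ 'n"
  assumes "CARD('d) < CARD('m)" and "CARD('m) \<le> CARD('n)"
    and "row_selector R"
    and "tight_framelet W"
    and "K = K_matrix R W"
    and "\<beta> > 0" and "\<gamma> > 0"
  shows "local_minimizer (F_fun K r \<beta> \<gamma>) xs ys \<longleftrightarrow>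
    is_arg_min (\<lambda>(x, y). G_fun K r \<beta> \<gamma> x y)
      (\<lambda>p. p \<in> supported_on (supp xs) \<times> UNIV) (xs, ys)"
proof -
  \<comment> \<open>\<open>is_arg_min\<close> only forbids strictly smaller values; as the reals are
    linearly ordered this is the usual inequality. Feasibility of (xs, ys) is automatic.\<close>
  have "is_arg_min (\<lambda>(x, y). G_fun K r \<beta> \<gamma> x y)
      (\<lambda>p. p \<in> supported_on (supp xs) \<times> UNIV) (xs, ys) \<longleftrightarrow>
    (\<forall>x y. supp x \<subseteq> supp xs \<longrightarrow> G_fun K r \<beta> \<gamma> xs ys \<le> G_fun K r \<beta> \<gamma> x y)"
    by (auto simp: is_arg_min_linorder supported_on_def)
  then show ?thesis
    using local_minimizer_imp_minimizer[OF \<open>\<beta> > 0\<close> \<open>\<gamma> > 0\<close>]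
      minimizer_imp_local_minimizer[OF \<open>\<gamma> > 0\<close>] by metis
qed

end
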